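(* Let $f:\mathbb{R}^{d\times N}\to\overline{\mathbb{R}}$. Then for every $\lambda\in\mathbb{R}$ $$L_\lambda(f^{lslc})=\bigcap_{\varepsilon>0}\overline{\operatorname{co}(L_{\lambda+\varepsilon}(f))}.$$
   Context: $\overline{\mathbb{R}}=[-\infty,+\infty]$. For $g:\mathbb{R}^{d\times N}\to\overline{\mathbb{R}}$ and $\lambda\in\mathbb{R}$, $L_\lambda(g)=\{\xi:g(\xi)\le\lambda\}$; $\operatorname{co}S$ is the convex hull of $S$ and $\overline S$ its closure in the usual topology. A function is level convex if all its sublevel sets $L_\lambda$, $\lambda\in\mathbb{R}$, are convex. $f^{lslc}$ is the pointwise supremum of all functions $g:\mathbb{R}^{d\times N}\to\overline{\mathbb{R}}$ that are lower semicontinuous and level convex and satisfy $g\le f$. *)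

theory Defs
  imports "HOL-Analysis.Analysis"
begin

definition sublevel :: "('a \<Rightarrow> ereal) \<Rightarrow> real \<Rightarrow> 'a set" where
  "sublevel g l = {x. g x \<le> ereal l}"

definition level_convex :: "('a::real_vector \<Rightarrow> ereal) \<Rightarrow> bool" where
  "level_convex g \<longleftrightarrow> (\<forall>l::real. convex (sublevel g l))"

(* The filter "at x" excludes x itself. This does not affect the condition, because
   the value at x always satisfies g x \<le> g x. *)
definition lower_semicontinuous :: "('a::topological_space \<Rightarrow> ereal) \<Rightarrow> bool" where
  "lower_semicontinuous g \<longleftrightarrow> (\<forall>x. g x \<le> Liminf (at x) g)"

definition lslc_envelope ::
    "('a::real_normed_vector \<Rightarrow> ereal) \<Rightarrow> 'a \<Rightarrow> ereal" where
  "lslc_envelope f x =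
     (SUP g \<in> {g. lower_semicontinuous g \<and> level_convex g \<and> (\<forall>y. g y \<le> f y)}. g x)"

end

theory Submission
  imports Defs
begin

text \<open>A function is lower semicontinuous and level convex iff all its sublevel sets are closed and
  convex. Hence the sets \<open>C m = closure (convex hull (sublevel f m))\<close> sit inside the corresponding
  sublevel sets of every competitor. Conversely, the gauge \<open>x \<mapsto> inf {m. x \<in> C m}\<close> is itself a
  competitor, because its sublevel set at level \<open>l\<close> is the intersection of the \<open>C (l + e)\<close>.\<close>

text \<open>Via \<open>le_Liminf_iff\<close>, lower semicontinuity says that any strict lower bound
  of \<open>g x\<close> persists near \<open>x\<close>, i.e. complements of sublevel sets are
  neighbourhoods of their points.\<close>

lemma lower_semicontinuous_iff_closed_sublevel:
  "lower_semicontinuous g \<longleftrightarrow> (\<forall>l. closed (sublevel g l))"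
proof
  assume lsc: "lower_semicontinuous g"
  show "\<forall>l. closed (sublevel g l)"
  proof
    fix l
    have "\<exists>T. open T \<and> x \<in> T \<and> T \<subseteq> - sublevel g l" if "x \<in> - sublevel g l" for x
    proof -
      from that have gt: "ereal l < g x" by (simp add: sublevel_def)
      moreover have "g x \<le> Liminf (at x) g"
        using lsc by (simp add: lower_semicontinuous_def)
      ultimately have "\<forall>\<^sub>F y in at x. ereal l < g y"
        by (simp add: le_Liminf_iff)
      then obtain S where "open S" "x \<in> S" "\<forall>y\<in>S. y \<noteq> x \<longrightarrow> ereal l < g y"
        by (auto simp: eventually_at_topological)
      \<comment> \<open>The filter \<open>at x\<close> says nothing about \<open>x\<close> itself;
        \<open>gt\<close> covers that point.\<close>
      then show ?thesis
        using gt by (intro exI[of _ S]) (auto simp: sublevel_def not_le)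
    qed
    then show "closed (sublevel g l)"
      unfolding closed_def by (subst open_subopen) blast
  qed
next
  assume cl: "\<forall>l. closed (sublevel g l)"
  show "lower_semicontinuous g"
    unfolding lower_semicontinuous_def le_Liminf_iff
  proof (intro allI impI)
    fix x y
    assume "y < g x"
    \<comment> \<open>Closedness is given at real levels only, while \<open>y\<close> may be
      -\<infinity>; a real level in between bridges this.\<close>
    then obtain l where l: "y < ereal l" "ereal l < g x"
      using ereal_dense2 by blast
    have "open (- sublevel g l)" "x \<in> - sublevel g l"
      using cl l by (auto simp: sublevel_def)
    then have "\<forall>\<^sub>F z in at x. z \<in> - sublevel g l"
      by (rule eventually_at_in_open')
    then show "\<forall>\<^sub>F z in at x. y < g z"
      by (rule eventually_mono) (use l in \<open>auto simp: sublevel_def\<close>)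
  qed
qed

lemma sublevel_mono: "l \<le> m \<Longrightarrow> sublevel g l \<subseteq> sublevel g m"
  unfolding sublevel_def using order_trans[of _ "ereal l" "ereal m"] by auto

lemma sublevel_eq_Inter: "sublevel g l = (\<Inter>e\<in>{0<..}. sublevel g (l + e))"
proof
  show "sublevel g l \<subseteq> (\<Inter>e\<in>{0<..}. sublevel g (l + e))"
    by (intro INT_greatest sublevel_mono) simp
  show "(\<Inter>e\<in>{0<..}. sublevel g (l + e)) \<subseteq> sublevel g l"
    using ereal_le_epsilon2[of "g x" "ereal l" for x] by (simp add: sublevel_def subset_iff)
qed

text \<open>A point in none of the hulls gets \<infinity>, the infimum of the empty set; a point in
  all of them gets -\<infinity>.\<close>

definition hull_gauge :: "('a::real_normed_vector \<Rightarrow> ereal) \<Rightarrow> 'a \<Rightarrow> ereal" where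
  "hull_gauge f x = (INF m \<in> {m. x \<in> closure (convex hull (sublevel f m))}. ereal m)"

text \<open>The infimum need not be attained, hence the slack \<open>e\<close>: a gauge value at
  most \<open>l\<close> only yields some \<open>m < l + e\<close> whose hull contains
  \<open>x\<close>, and the hulls grow with the level.\<close>

lemma sublevel_hull_gauge:
  "sublevel (hull_gauge f) l = (\<Inter>e\<in>{0<..}. closure (convex hull (sublevel f (l + e))))"
proof (intro equalityI subsetI INT_I)
  fix x and e :: real
  assume "x \<in> sublevel (hull_gauge f) l" and "e \<in> {0<..}"
  then have "hull_gauge f x < ereal (l + e)"
    using le_less_trans[of _ "ereal l" "ereal (l + e)"] by (simp add: sublevel_def)
  then obtain m where "x \<in> closure (convex hull (sublevel f m))" "m < l + e"
    by (auto simp: hull_gauge_def INF_less_iff)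
  then show "x \<in> closure (convex hull (sublevel f (l + e)))"
    using closure_mono[OF hull_mono[OF sublevel_mono[of m "l + e" f]], of convex] by auto
next
  fix x
  assume "x \<in> (\<Inter>e\<in>{0<..}. closure (convex hull (sublevel f (l + e))))"
  then have "x \<in> sublevel (hull_gauge f) (l + e)" if "0 < e" for e
    using that by (auto simp: sublevel_def hull_gauge_def intro!: INF_lower)
  then show "x \<in> sublevel (hull_gauge f) l"
    unfolding sublevel_eq_Inter[of _ l] by auto
qed

lemma lower_semicontinuous_hull_gauge: "lower_semicontinuous (hull_gauge f)"
  by (auto simp: lower_semicontinuous_iff_closed_sublevel sublevel_hull_gauge)

lemma level_convex_hull_gauge: "level_convex (hull_gauge f)"
  by (auto simp: level_convex_def sublevel_hull_gauge intro!: convex_INT convex_closure)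

lemma hull_gauge_le: "hull_gauge f x \<le> f x"
\<comment> \<open>Testing against real upper bounds \<open>z\<close> of \<open>f x\<close> treats
  infinite values uniformly: there are none if \<open>f x\<close> is \<infinity>, and every real is
  one if it is -\<infinity>.\<close>
proof (rule ereal_le_real)
  fix z
  assume "f x \<le> ereal z"
  then have "x \<in> closure (convex hull (sublevel f z))"
    by (intro subsetD[OF closure_subset] hull_inc) (simp add: sublevel_def)
  then show "hull_gauge f x \<le> ereal z"
    by (auto simp: hull_gauge_def intro: INF_lower)
qed

lemma sublevel_lslc_envelope:
  "sublevel (lslc_envelope f) l = (\<Inter>e\<in>{0<..}. closure (convex hull (sublevel f (l + e))))"
proof
  have "hull_gauge f x \<le> lslc_envelope f x" for x
    unfolding lslc_envelope_def
    by (rule SUP_upper)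
      (simp add: lower_semicontinuous_hull_gauge level_convex_hull_gauge hull_gauge_le)
  then have "sublevel (lslc_envelope f) l \<subseteq> sublevel (hull_gauge f) l"
    unfolding sublevel_def using order_trans by blast
  then show "sublevel (lslc_envelope f) l
      \<subseteq> (\<Inter>e\<in>{0<..}. closure (convex hull (sublevel f (l + e))))"
    by (simp only: sublevel_hull_gauge)
next
  \<comment> \<open>The envelope is a supremum, so its sublevel set is the intersection of those of
    all competitors \<open>g\<close>; each can be treated separately.\<close>
  have "(\<Inter>e\<in>{0<..}. closure (convex hull (sublevel f (l + e)))) \<subseteq> sublevel g l"
    if g: "lower_semicontinuous g" "level_convex g" "\<forall>y. g y \<le> f y" for g
  proof -
    have "closure (convex hull (sublevel f m)) \<subseteq> sublevel g m" for m
    proof (intro closure_minimal hull_minimal)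
      show "sublevel f m \<subseteq> sublevel g m"
        unfolding sublevel_def using g(3) order_trans by blast
      show "convex (sublevel g m)"
        using g(2) by (simp add: level_convex_def)
      show "closed (sublevel g m)"
        using g(1) by (simp add: lower_semicontinuous_iff_closed_sublevel)
    qed
    then show ?thesis
      unfolding sublevel_eq_Inter[of g l] by blast
  qed
  then show "(\<Inter>e\<in>{0<..}. closure (convex hull (sublevel f (l + e))))
      \<subseteq> sublevel (lslc_envelope f) l"
    unfolding sublevel_def[of "lslc_envelope f"] lslc_envelope_def SUP_le_iff
    by (simp add: sublevel_def[of _ l] subset_iff)
qed

theorem proposition2p24:
  fixes f :: "real ^ 'N ^ 'd \<Rightarrow> ereal"
  shows "\<forall>l::real. sublevel (lslc_envelope f) l =
           (\<Inter>e\<in>{0::real<..}. closure (convex hull (sublevel f (l + e))))"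
  by (simp add: sublevel_lslc_envelope)

end
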